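(* If $P$ is a regular $N$-gon, any two star points of $P$ are sufficient to determine the center and the height of $P$.
   Context: The height of a regular $N$-gon is its apothem. The star points of a regular $N$-gon $P$ are the intersections of the extended edges of $P$ with one fixed extended edge of $P$, which by convention is taken to be the horizontal base edge. They are numbered outwards, starting from $\mathrm{star}[1]$, which is a vertex of $P$. Explicitly, if $P$ has center $cP$ and height $hP$, then for $1\le k<N/2$ the star points $\mathrm{star}[k]$ are $cP+(\pm hP\tan(k\pi/N),-hP)$, with sign $+$ for the right side and $-$ for the left side of $P$. The star points are given by their coordinates in a known coordinate system. *)

theory Defs
  imports "HOL-Analysis.Analysis"
begin

text \<open>
  The plane is the type \<^typ>\<open>complex\<close>. A polygon is the function listing its vertices in
  cyclic order, so that vertex \<open>k\<close> and vertex \<open>k + N\<close> of an \<open>N\<close>-gon coincide. Edge \<open>k\<close> joins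
  vertex \<open>k\<close> to vertex \<open>k + 1\<close>; edge \<open>0\<close> is the base edge.
\<close>

definition regular_ngon :: "nat \<Rightarrow> (nat \<Rightarrow> complex) \<Rightarrow> bool" where
  "regular_ngon N P \<longleftrightarrow> N \<ge> 3 \<and>
     (\<exists>c r \<theta>. r > 0 \<and> (\<forall>k. P k = c + of_real r * cis (\<theta> + 2 * pi * real k / real N)))"

text \<open>
  The vertices are listed counterclockwise, hence a base edge that runs from left to right
  has the polygon above it.
\<close>

definition horizontal_base :: "(nat \<Rightarrow> complex) \<Rightarrow> bool" where
  "horizontal_base P \<longleftrightarrow> Im (P 0) = Im (P 1) \<and> Re (P 0) < Re (P 1)"

definition center :: "nat \<Rightarrow> (nat \<Rightarrow> complex) \<Rightarrow> complex" where
  "center N P = (\<Sum>k<N. P k) / of_nat N"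

text \<open>The height is the apothem: the distance from the center to the midpoint of an edge.\<close>

definition height :: "nat \<Rightarrow> (nat \<Rightarrow> complex) \<Rightarrow> real" where
  "height N P = dist (center N P) (midpoint (P 0) (P 1))"

definition extended_edge :: "(nat \<Rightarrow> complex) \<Rightarrow> nat \<Rightarrow> complex set" where
  "extended_edge P k = affine hull {P k, P (Suc k)}"

datatype side = Left_Side | Right_Side

fun on_side :: "side \<Rightarrow> complex \<Rightarrow> complex \<Rightarrow> bool" where
  "on_side Left_Side c p \<longleftrightarrow> Re p < Re c"
| "on_side Right_Side c p \<longleftrightarrow> Re p > Re c"

definition star_points :: "nat \<Rightarrow> (nat \<Rightarrow> complex) \<Rightarrow> side \<Rightarrow> complex set" where
  "star_points N P s =
     {p. (\<exists>i\<in>{1..<N}. p \<in> extended_edge P 0 \<inter> extended_edge P i) \<and> on_side s (center N P) p}"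

text \<open>
  Numbering outwards: the \<open>k\<close>-th star point on a side is the one for which exactly \<open>k\<close> star
  points of that side, itself included, are at most as far from the vertical axis of the
  polygon. This is meaningful for \<open>1 \<le> k < N/2\<close>, and \<open>k = 1\<close> gives a vertex of the base edge.
\<close>

definition star :: "nat \<Rightarrow> (nat \<Rightarrow> complex) \<Rightarrow> side \<Rightarrow> nat \<Rightarrow> complex" where
  "star N P s k = (THE p. p \<in> star_points N P s \<and>
     card {q \<in> star_points N P s.
             \<bar>Re q - Re (center N P)\<bar> \<le> \<bar>Re p - Re (center N P)\<bar>} = k)"

end

theory Submission
  imports Defs
begin

text \<open>
  Place the center at the origin and put \<open>\<alpha> = \<pi> / N\<close>. Edge \<open>i\<close> spans the line at distance \<open>h\<close> from
  the center with unit normal \<open>- \<i> * cis (2 * i * \<alpha>)\<close>, so it meets the base line \<open>y = -h\<close> where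
  \<open>x * cos (i * \<alpha>) = h * sin (i * \<alpha>)\<close>. Since \<open>tan\<close> is increasing, the \<open>k\<close>-th star point is
  \<open>(\<plusminus>h * tan (k * \<alpha>), -h)\<close>. The abscissae of two different star points differ by a known nonzero
  multiple of \<open>h\<close>; this yields \<open>h\<close>, and then either point yields the center.
\<close>

section \<open>Edge lines and vertices of a regular polygon in coordinates\<close>

text \<open>Since \<open>e\<close> has norm 1, the map taking \<open>p\<close> to
  \<open>(p - c) * cnj e\<close> is rigid and sends both points to the vertical line with real part
  \<open>h\<close>. They stay distinct because \<open>w\<close> is nonzero, so they span all of
  it.\<close>

lemma affine_hull_chord:
  fixes c e p :: complex
  assumes e: "cmod e = 1" and w: "w \<noteq> 0"
  shows "p \<in> affine hull {c + e * Complex h (- w), c + e * Complex h w}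
           \<longleftrightarrow> Re ((p - c) * cnj e) = h"
proof
  have ee: "e * cnj e = 1"
    using e by (simp flip: complex_norm_square)
  {
    assume "p \<in> affine hull {c + e * Complex h (- w), c + e * Complex h w}"
    then obtain u v where uv: "u + v = 1"
      and p: "p = u *\<^sub>R (c + e * Complex h (- w)) + v *\<^sub>R (c + e * Complex h w)"
      by (auto simp: affine_hull_2)
    have "p - c = e * (u *\<^sub>R Complex h (- w) + v *\<^sub>R Complex h w) + (u + v) *\<^sub>R c - c"
      unfolding p by (simp add: algebra_simps)
    hence "p - c = e * (u *\<^sub>R Complex h (- w) + v *\<^sub>R Complex h w)"
      using uv by simp
    hence "(p - c) * cnj e = (e * cnj e) * (u *\<^sub>R Complex h (- w) + v *\<^sub>R Complex h w)"
      by (simp only: mult_ac)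
    hence "Re ((p - c) * cnj e) = (u + v) * h"
      by (simp add: ee algebra_simps)
    thus "Re ((p - c) * cnj e) = h"
      using uv by simp
  }
  {
    assume h: "Re ((p - c) * cnj e) = h"
    define t where "t = Im ((p - c) * cnj e)"
    have "p - c = e * ((p - c) * cnj e)"
      using ee by (simp add: mult_ac)
    also have "(p - c) * cnj e = Complex h t"
      using h t_def by (simp add: complex_eq_iff)
    finally have pc: "p = c + e * Complex h t"
      by (simp add: algebra_simps)
    \<comment> \<open>This solves \<open>(1 - v) * (- w) + v * w = t\<close>.\<close>
    define v where "v = (t / w + 1) / 2"
    have "Complex h t = (1 - v) *\<^sub>R Complex h (- w) + v *\<^sub>R Complex h w"
      using w by (simp add: complex_eq_iff v_def field_simps)
    from pc[unfolded this]
    have "p = (1 - v) *\<^sub>R (c + e * Complex h (- w)) + v *\<^sub>R (c + e * Complex h w)"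
      by (simp add: algebra_simps)
    moreover have "(1 - v) + v = 1"
      by simp
    ultimately show "p \<in> affine hull {c + e * Complex h (- w), c + e * Complex h w}"
      unfolding affine_hull_2 by blast
  }
qed

text \<open>A geometric sum whose ratio is an \<open>N\<close>-th root of unity other than 1. It
  identifies the mean of the vertices with the circumcenter.\<close>

lemma sum_cis_roots_of_unity:
  assumes "N \<ge> 3"
  shows "(\<Sum>k<N. cis (2 * pi * real k / real N)) = 0"
proof -
  let ?x = "cis (2 * pi / real N)"
  have "sin (2 * pi / real N) > 0"
    using assms by (intro sin_gt_zero) (auto simp: field_simps)
  hence "Im ?x \<noteq> Im 1"
    by simp
  hence "?x \<noteq> 1"
    by metis
  moreover have "real N * (2 * pi / real N) = 2 * pi"
    using assms by auto
  hence "?x ^ N = 1"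
    by (simp only: Complex.DeMoivre cis_2pi)
  moreover have "?x ^ k = cis (2 * pi * real k / real N)" for k
    by (simp add: Complex.DeMoivre mult_ac)
  ultimately show ?thesis
    using geometric_sum[of ?x N] by simp
qed

text \<open>The half step \<alpha> turns the direction of vertex 0 into that of the midpoint of the
  base edge, which a base running from left to right forces to be \<open>- \<i>\<close>. Then
  \<open>h = r * cos \<alpha>\<close> is the apothem, \<open>w = r * sin \<alpha>\<close> is half an
  edge, and the factor before \<open>Complex\<close> is the outward unit normal of edge
  \<open>k\<close>.\<close>

lemma regular_ngon_horizontal_cases:
  assumes "regular_ngon N P" and "horizontal_base P"
  obtains c h w where "N \<ge> 3" and "h > 0" and "w > 0"
    and "\<And>k. P k = c + - \<i> * cis (2 * pi * real k / real N) * Complex h (- w)"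
    and "\<And>k. P (Suc k) = c + - \<i> * cis (2 * pi * real k / real N) * Complex h w"
proof -
  obtain c r \<theta> where N: "N \<ge> 3" and r: "r > 0"
    and P: "\<And>k. P k = c + of_real r * cis (\<theta> + 2 * pi * real k / real N)"
    using assms(1) by (auto simp: regular_ngon_def)
  define \<alpha> where "\<alpha> = pi / real N"
  have \<alpha>: "0 < \<alpha>" "\<alpha> < pi / 2"
    using N by (auto simp: \<alpha>_def field_simps)
  have cos: "cos \<alpha> > 0" and sin: "sin \<alpha> > 0"
    using \<alpha> by (auto intro: cos_gt_zero sin_gt_zero)
  define \<phi> where "\<phi> = \<theta> + \<alpha>"
  have Pk: "P k = c + of_real r * (cis \<phi> * cis (2 * pi * real k / real N) * cis (- \<alpha>))" for k
    unfolding P cis_mult \<phi>_def by (simp add: algebra_simps)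
  have PS: "P (Suc k) = c + of_real r * (cis \<phi> * cis (2 * pi * real k / real N) * cis \<alpha>)" for k
  proof -
    have "\<theta> + 2 * pi * real (Suc k) / real N = \<phi> + 2 * pi * real k / real N + \<alpha>"
      by (simp add: \<phi>_def \<alpha>_def add_divide_distrib algebra_simps)
    thus ?thesis
      by (simp only: P cis_mult)
  qed
  have base: "Im (P 0) = Im (P (Suc 0))" "Re (P 0) < Re (P (Suc 0))"
    using assms(2) by (auto simp: horizontal_base_def)
  \<comment> \<open>The base edge as a vector is
    \<open>2 * r * sin \<alpha> * \<i> * cis \<phi>\<close>; its imaginary part vanishes and its
    real part is positive.\<close>
  have "cos \<phi> * sin \<alpha> = 0"
    using base(1) r unfolding Pk[of 0] PS[of 0] by (simp add: algebra_simps)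
  hence cos\<phi>: "cos \<phi> = 0"
    using sin by simp
  have "r * (sin \<phi> * sin \<alpha>) < 0"
    using base(2) unfolding Pk[of 0] PS[of 0] by (simp add: algebra_simps)
  hence "sin \<phi> < 0"
    using r sin by (simp add: mult_less_0_iff)
  hence "sin \<phi> = -1"
    using cos\<phi> sin_cos_squared_add[of \<phi>] by (auto simp: power2_eq_1_iff)
  hence \<phi>: "cis \<phi> = - \<i>"
    using cos\<phi> by (simp add: complex_eq_iff)
  have A: "Complex (r * cos \<alpha>) (- (r * sin \<alpha>)) = of_real r * cis (- \<alpha>)"
    and B: "Complex (r * cos \<alpha>) (r * sin \<alpha>) = of_real r * cis \<alpha>"
    by (auto simp: complex_eq_iff)
  show thesis
  proof (rule that[of "r * cos \<alpha>" "r * sin \<alpha>" c])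
    show "P k = c + - \<i> * cis (2 * pi * real k / real N) *
        Complex (r * cos \<alpha>) (- (r * sin \<alpha>))" for k
      unfolding Pk A \<phi> by (simp add: mult_ac)
    show "P (Suc k) = c + - \<i> * cis (2 * pi * real k / real N) *
        Complex (r * cos \<alpha>) (r * sin \<alpha>)" for k
      unfolding PS B \<phi> by (simp add: mult_ac)
  qed (use N r cos sin in auto)
qed

section \<open>Intersections of the base line with another edge line\<close>

fun side_sign :: "side \<Rightarrow> real" where
  "side_sign Left_Side = -1"
| "side_sign Right_Side = 1"

text \<open>With \<open>y = - h\<close> the second equation reads
  \<open>x * sin (2 * a) = h * (1 - cos (2 * a))\<close>, and the double angle formulas give both
  sides the factor \<open>2 * sin a\<close>. It is nonzero exactly when the two lines differ; if
  \<open>cos a = 0\<close>, they are parallel.\<close>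

lemma base_line_meets_edge:
  fixes a h x y :: real
  assumes "sin a \<noteq> 0" and "h > 0"
  shows "Re (Complex x y * cnj (- \<i>)) = h \<and> Re (Complex x y * cnj (- \<i> * cis (2 * a))) = h
           \<longleftrightarrow> y = - h \<and> cos a \<noteq> 0 \<and> x = h * tan a"
proof -
  have "Re (Complex x (- h) * cnj (- \<i> * cis (2 * a))) = h
          \<longleftrightarrow> 2 * sin a * (x * cos a) = 2 * sin a * (h * sin a)"
    unfolding cis.ctr cos_double_sin sin_double
    by (simp add: algebra_simps power2_eq_square)
  also have "\<dots> \<longleftrightarrow> x * cos a = h * sin a"
    using assms(1) by simp
  also have "\<dots> \<longleftrightarrow> cos a \<noteq> 0 \<and> x = h * tan a"
    using assms by (cases "cos a = 0") (auto simp: tan_def field_simps)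
  finally have "Re (Complex x (- h) * cnj (- \<i> * cis (2 * a))) = h
      \<longleftrightarrow> cos a \<noteq> 0 \<and> x = h * tan a" .
  moreover have "Re (Complex x y * cnj (- \<i>)) = h \<longleftrightarrow> y = - h"
    by auto
  ultimately show ?thesis
    by metis
qed

section \<open>Tangents of multiples of pi / N\<close>

lemma tan_pi_fraction_less:
  assumes "i < j" and "2 * j < N"
  shows "tan (real i * pi / real N) < tan (real j * pi / real N)"
proof (rule tan_monotone)
  show "- (pi / 2) < real i * pi / real N"
    by (rule less_le_trans[of _ 0]) auto
  show "real i * pi / real N < real j * pi / real N"
    using assms by (auto intro!: divide_strict_right_mono)
  have "real (2 * j) * pi < real N * pi"
    using assms by (intro mult_strict_right_mono) auto
  thus "real j * pi / real N < pi / 2"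
    using assms by (simp add: field_simps)
qed

lemma tan_pi_fraction_le_iff:
  assumes "2 * i < N" and "2 * j < N"
  shows "tan (real i * pi / real N) \<le> tan (real j * pi / real N) \<longleftrightarrow> i \<le> j"
  using assms tan_pi_fraction_less[of i j N] tan_pi_fraction_less[of j i N]
  by (cases i j rule: linorder_cases) auto

lemma tan_pi_fraction_pos:
  assumes "1 \<le> i" and "2 * i < N"
  shows "tan (real i * pi / real N) > 0"
  using tan_pi_fraction_less[of 0 i N] assms by simp

text \<open>Reflection in the vertical axis of the polygon exchanges edges \<open>i\<close> and
  \<open>N - i\<close>; for the tangent this is oddness combined with period
  \<open>pi\<close>.\<close>

lemma tan_pi_fraction_reflect:
  assumes "i < N"
  shows "tan (real (N - i) * pi / real N) = - tan (real i * pi / real N)"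
proof -
  have "real (N - i) * pi / real N = - (real i * pi / real N) + pi"
    using assms by (simp add: field_simps of_nat_diff)
  thus ?thesis
    by (simp only: tan_periodic_pi tan_minus)
qed

section \<open>The star points and their numbering\<close>

text \<open>Edge \<open>i\<close> meets the base line on the right for \<open>2 * i < N\<close>, on
  the left for \<open>2 * i > N\<close>, and is parallel to it for \<open>2 * i = N\<close>.
  Replacing \<open>i\<close> by \<open>N - i\<close> on the left gives both sides the same index
  set.\<close>

lemma star_points_eq:
  assumes N: "N \<ge> 3" and h: "h > 0" and w: "w > 0" and c: "center N P = c"
    and P: "\<And>k. P k = c + - \<i> * cis (2 * pi * real k / real N) * Complex h (- w)"
    and PS: "\<And>k. P (Suc k) = c + - \<i> * cis (2 * pi * real k / real N) * Complex h w"
  shows "star_points N P s =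
    (\<lambda>i. c + Complex (side_sign s * (h * tan (real i * pi / real N))) (- h)) ` {i. 1 \<le> i \<and> 2 * i < N}"
    (is "_ = ?f ` ?I")
proof -
  let ?a = "\<lambda>i. real i * pi / real N"
  have edge: "p \<in> extended_edge P i \<longleftrightarrow>
      Re ((p - c) * cnj (- \<i> * cis (2 * ?a i))) = h" for p i
  proof -
    have "cmod (- \<i> * cis (2 * ?a i)) = 1"
      by (simp add: norm_mult)
    from affine_hull_chord[OF this, of w p c h] show ?thesis
      unfolding extended_edge_def PS P[of i] using w by (simp add: mult_ac)
  qed
  have inter: "p \<in> extended_edge P 0 \<inter> extended_edge P i \<longleftrightarrow>
      cos (?a i) \<noteq> 0 \<and> p = c + Complex (h * tan (?a i)) (- h)" if "i \<in> {1..<N}" for p i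
  proof -
    have "sin (?a i) > 0"
      using that N by (intro sin_gt_zero) (auto simp: field_simps)
    hence "sin (?a i) \<noteq> 0"
      by simp
    from base_line_meets_edge[OF this h, of "Re (p - c)" "Im (p - c)"]
    have "p \<in> extended_edge P 0 \<inter> extended_edge P i \<longleftrightarrow>
        Im (p - c) = - h \<and> cos (?a i) \<noteq> 0 \<and> Re (p - c) = h * tan (?a i)"
      by (simp add: edge)
    thus ?thesis
      by (auto simp: complex_eq_iff)
  qed
  have mem: "p \<in> star_points N P s \<longleftrightarrow>
      (\<exists>i\<in>{1..<N}. cos (?a i) \<noteq> 0 \<and> p = c + Complex (h * tan (?a i)) (- h)) \<and> on_side s c p" for p
    unfolding star_points_def c using inter by blast
  \<comment> \<open>As division by zero yields 0, a nonzero tangent already implies a nonzero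
    cosine.\<close>
  have low: "i \<in> {1..<N}" "cos (?a i) \<noteq> 0" "tan (?a i) > 0" if "i \<in> ?I" for i
    using that tan_pi_fraction_pos[of i N] by (auto simp: tan_def)
  have trichotomy: "i \<in> ?I \<or> N - i \<in> ?I" if i: "i \<in> {1..<N}" "cos (?a i) \<noteq> 0" for i
  proof -
    have "2 * i \<noteq> N"
    proof
      assume "2 * i = N"
      hence "real N = 2 * real i"
        by linarith
      hence "?a i = pi / 2"
        using i(1) by simp
      thus False
        using i(2) cos_pi_half by metis
    qed
    thus ?thesis
      using i by auto
  qed
  have tan_reflect: "tan (?a (N - i)) = - tan (?a i)" if "i \<in> {1..<N}" for i
    using that by (intro tan_pi_fraction_reflect) auto
  show ?thesis
  proof (intro equalityI subsetI)
    fix p assume "p \<in> star_points N P s"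
    then obtain i where i: "i \<in> {1..<N}" "cos (?a i) \<noteq> 0"
      and p: "p = c + Complex (h * tan (?a i)) (- h)" and s: "on_side s c p"
      by (auto simp: mem)
    show "p \<in> ?f ` ?I"
    proof (cases s)
      case Right_Side
      hence "tan (?a i) > 0"
        using s h by (simp add: p zero_less_mult_iff)
      hence "i \<in> ?I"
        \<comment> \<open>Were \<open>N - i\<close> in \<open>?I\<close>, its tangent would be
          positive and that of \<open>i\<close> negative.\<close>
        using trichotomy[OF i] low(3)[of "N - i"] tan_reflect[OF i(1)] by auto
      thus ?thesis
        using Right_Side p by (intro image_eqI[of _ _ i]) auto
    next
      case Left_Side
      hence "tan (?a i) < 0"
        using s h by (simp add: p mult_less_0_iff)
      hence "N - i \<in> ?I"
        using trichotomy[OF i] low(3)[of i] by auto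
      thus ?thesis
        using Left_Side p tan_reflect[OF i(1)] by (intro image_eqI[of _ _ "N - i"]) auto
    qed
  next
    fix p assume "p \<in> ?f ` ?I"
    then obtain i where i: "i \<in> ?I" and p: "p = ?f i"
      by blast
    note low = low[OF i]
    show "p \<in> star_points N P s"
    proof (cases s)
      case Right_Side
      thus ?thesis
        unfolding mem using low h p by auto
    next
      case Left_Side
      have refl: "tan (?a (N - i)) = - tan (?a i)"
        using tan_reflect low by blast
      hence "cos (?a (N - i)) \<noteq> 0"
        using low(3) by (auto simp: tan_def)
      moreover have "p = c + Complex (h * tan (?a (N - i))) (- h)"
        unfolding refl using p Left_Side by simp
      moreover have "N - i \<in> {1..<N}"
        using low(1) by auto
      moreover have "on_side s c p"
        using Left_Side p h low(3) by simp
      ultimately show ?thesis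
        unfolding mem by blast
    qed
  qed
qed

text \<open>The distance \<open>h * tan (i * pi / N)\<close> from the vertical axis grows strictly
  with \<open>i\<close>, so the points at most as far out as the \<open>i\<close>-th are those with
  indices \<open>1\<close> to \<open>i\<close>. The count thus returns the index, which gives both
  existence and uniqueness for \<open>THE\<close>.\<close>

lemma star_eq:
  assumes h: "h > 0" and k: "1 \<le> k" "2 * k < N"
    and S: "star_points N P s =
      (\<lambda>i. center N P + Complex (side_sign s * (h * tan (real i * pi / real N))) (- h))
        ` {i. 1 \<le> i \<and> 2 * i < N}"
  shows "star N P s k =
    center N P + Complex (side_sign s * (h * tan (real k * pi / real N))) (- h)"
proof -
  let ?c = "center N P" and ?I = "{i. 1 \<le> i \<and> 2 * i < N}"
  let ?f = "\<lambda>i. ?c + Complex (side_sign s * (h * tan (real i * pi / real N))) (- h)"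
  have dist: "\<bar>Re (?f i) - Re ?c\<bar> = h * tan (real i * pi / real N)" if "i \<in> ?I" for i
    using that h tan_pi_fraction_pos[of i N] by (cases s) (auto simp: abs_mult)
  have inj: "inj_on ?f ?I"
  proof (rule inj_onI)
    fix i j assume ij: "i \<in> ?I" "j \<in> ?I" "?f i = ?f j"
    hence "tan (real i * pi / real N) = tan (real j * pi / real N)"
      using h by (cases s) auto
    thus "i = j"
      using tan_pi_fraction_le_iff[of i N j] tan_pi_fraction_le_iff[of j N i] ij by auto
  qed
  have card: "card {q \<in> star_points N P s. \<bar>Re q - Re ?c\<bar> \<le> \<bar>Re (?f i) - Re ?c\<bar>} = i"
    if i: "i \<in> ?I" for i
  proof -
    have le: "\<bar>Re (?f m) - Re ?c\<bar> \<le> \<bar>Re (?f i) - Re ?c\<bar> \<longleftrightarrow> m \<le> i" if "m \<in> ?I" for m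
      unfolding dist[OF that] dist[OF i] using that i h by (simp add: tan_pi_fraction_le_iff)
    have "{q \<in> star_points N P s. \<bar>Re q - Re ?c\<bar> \<le> \<bar>Re (?f i) - Re ?c\<bar>} =
        ?f ` {m \<in> ?I. \<bar>Re (?f m) - Re ?c\<bar> \<le> \<bar>Re (?f i) - Re ?c\<bar>}"
      unfolding S by blast
    also have "{m \<in> ?I. \<bar>Re (?f m) - Re ?c\<bar> \<le> \<bar>Re (?f i) - Re ?c\<bar>} = {m \<in> ?I. m \<le> i}"
      using le by blast
    also have "\<dots> = {1..i}"
      using i by auto
    also have "card (?f ` {1..i}) = card {1..i}"
      using i by (intro card_image inj_on_subset[OF inj]) auto
    finally show ?thesis
      by simp
  qed
  have kI: "k \<in> ?I"
    using k by simp
  show ?thesis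
    unfolding star_def
  proof (rule the_equality, intro conjI)
    show "?f k \<in> star_points N P s"
      unfolding S using kI by (rule imageI)
    show "card {q \<in> star_points N P s. \<bar>Re q - Re ?c\<bar> \<le> \<bar>Re (?f k) - Re ?c\<bar>} = k"
      by (rule card[OF kI])
  next
    fix p
    assume p: "p \<in> star_points N P s \<and>
      card {q \<in> star_points N P s. \<bar>Re q - Re ?c\<bar> \<le> \<bar>Re p - Re ?c\<bar>} = k"
    then obtain i where "i \<in> ?I" "p = ?f i"
      unfolding S by blast
    thus "p = ?f k"
      using p card[of i] by simp
  qed
qed

text \<open>The vertex mean is \<open>c\<close>, because the roots of unity cancel, and the midpoint
  of the base edge lies \<open>h\<close> below it; so the parameters \<open>c\<close> and
  \<open>h\<close> are the center and the height.\<close>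

lemma star_horizontal_ngon:
  assumes P: "regular_ngon N P" "horizontal_base P" and k: "1 \<le> k" "2 * k < N"
  shows "star N P s k = center N P +
    Complex (side_sign s * (height N P * tan (real k * pi / real N))) (- height N P)"
proof -
  obtain c h w where N: "N \<ge> 3" and h: "h > 0" and w: "w > 0"
    and Pk: "\<And>k. P k = c + - \<i> * cis (2 * pi * real k / real N) * Complex h (- w)"
    and PS: "\<And>k. P (Suc k) = c + - \<i> * cis (2 * pi * real k / real N) * Complex h w"
    by (rule regular_ngon_horizontal_cases[OF P]) (rule that)
  have "(\<Sum>k<N. P k) =
      of_nat N * c + - \<i> * (\<Sum>k<N. cis (2 * pi * real k / real N)) * Complex h (- w)"
    unfolding Pk sum.distrib sum_distrib_left sum_distrib_right by simp
  hence c: "center N P = c"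
    using N by (simp add: center_def sum_cis_roots_of_unity)
  have "midpoint (P 0) (P 1) = c + Complex 0 (- h)"
    using Pk[of 0] PS[of 0] by (simp add: midpoint_def complex_eq_iff)
  hence "height N P = cmod (Complex 0 (- h))"
    by (simp add: height_def c dist_norm norm_minus_commute)
  hence height: "height N P = h"
    using h by (simp add: cmod_def)
  have "star_points N P s =
      (\<lambda>i. center N P + Complex (side_sign s * (h * tan (real i * pi / real N))) (- h))
        ` {i. 1 \<le> i \<and> 2 * i < N}"
    unfolding c by (rule star_points_eq[OF N h w c Pk PS])
  from star_eq[OF h k this] show ?thesis
    unfolding height .
qed

section \<open>Recovering center and height from two star points\<close>

theorem lemma1p3:
  fixes N j k :: nat and s t :: side
  assumes "1 \<le> j" and "real j < real N / 2"
    and "1 \<le> k" and "real k < real N / 2"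
    and "(s, j) \<noteq> (t, k)"
  shows "\<exists>F :: complex \<Rightarrow> complex \<Rightarrow> complex \<times> real.
           \<forall>P. regular_ngon N P \<and> horizontal_base P \<longrightarrow>
             F (star N P s j) (star N P t k) = (center N P, height N P)"
proof -
  have j: "1 \<le> j" "2 * j < N" and k: "1 \<le> k" "2 * k < N"
    using assms by linarith+
  define a where "a = side_sign s * tan (real j * pi / real N)"
  define b where "b = side_sign t * tan (real k * pi / real N)"
  \<comment> \<open>Opposite sides give opposite signs; on one side the numbers differ, and so do
    the tangents.\<close>
  have "a \<noteq> b"
    using assms(5) tan_pi_fraction_pos[OF j] tan_pi_fraction_pos[OF k]
      tan_pi_fraction_le_iff[OF j(2) k(2)] tan_pi_fraction_le_iff[OF k(2) j(2)]
    by (cases s; cases t) (auto simp: a_def b_def)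
  \<comment> \<open>Only \<open>N\<close>, the sides and the numbers enter \<open>a\<close> and
    \<open>b\<close>, so one \<open>F\<close> serves every polygon.\<close>
  define H where "H p q = Re (p - q) / (a - b)" for p q
  define F where "F p q = (p - Complex (a * H p q) (- H p q), H p q)" for p q
  have "F (star N P s j) (star N P t k) = (center N P, height N P)"
    if P: "regular_ngon N P" "horizontal_base P" for P
  proof -
    have S: "star N P s j = center N P + Complex (a * height N P) (- height N P)"
      and T: "star N P t k = center N P + Complex (b * height N P) (- height N P)"
      unfolding star_horizontal_ngon[OF P j] star_horizontal_ngon[OF P k] a_def b_def
      by (simp_all add: mult_ac)
    have "Re (star N P s j - star N P t k) = (a - b) * height N P"
      unfolding S T by (simp add: algebra_simps)
    hence "H (star N P s j) (star N P t k) = height N P"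
      using \<open>a \<noteq> b\<close> by (simp add: H_def)
    thus ?thesis
      by (simp add: F_def S)
  qed
  thus ?thesis
    by blast
qed

end
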